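(* Let $X_h,Q_h$ be fixed finite-dimensional Hilbert spaces, $a>0$, and let $G_h:X_h\to Q_h$, $D_h:Q_h\to X_h$ be linear with $D_h=-G_h^*$. Let $C\in[C_-,C_+]$ and $\Delta t>0$ be fixed. Assume the exact closure $\mathcal G_h(U)=A_{h,\delta}^2U$ and exact solution of the two implicit stages, so that the one-step map is $R(\Delta tA_{h,\delta})$. Then there are $\delta_0>0$ and $K_{h,\Delta t}>0$ such that, in operator norm, $$\left\|R(\Delta t A_{h,\delta})-E_hR(\Delta t L_{D,h})P_h\right\|\le K_{h,\Delta t}\,\delta,\qquad 0<\delta\le\delta_0.$$
   Context: On $X_h\times Q_h$ define, for $\delta>0$, $$A_{h,\delta}=\begin{bmatrix}0&-D_h\\-(a/\delta)G_h&-(1/\delta)I\end{bmatrix},\qquad L_{D,h}=-aG_h^*G_h\ \text{ on }X_h,$$ $$P_h(u,q)^T=u,\qquad E_hu=(u,-aG_hu)^T.$$ Set $C_\pm=\frac{25\pm\sqrt{105}}{780}$, $a_0=\frac16+\frac72C$, $a_1=\frac23-10C$, $a_2=\frac16+\frac{13}2C$, $H(z)=\frac{1+z/4+z^2/48}{1-z/4+z^2/48}$ and $$R(z)=\frac{1+a_0z+Cz^2+(a_1z-Cz^2)H(z)}{1-a_2z+\frac32Cz^2}.$$ For a linear operator $M$ with no eigenvalue at a pole of $R$, $R(M)$ denotes the rational function of $M$. The two stages of the time method for $U_t=A_{h,\delta}U$ with exact closure are $[I-\frac{\Delta t}4A+\frac{\Delta t^2}{48}A^2]U^\star=[I+\frac{\Delta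 t}4A+\frac{\Delta t^2}{48}A^2]U^n$ and $[I-a_2\Delta tA+\frac32C\Delta t^2A^2]U^{n+1}=[I+a_0\Delta tA+C\Delta t^2A^2]U^n+[a_1\Delta tA-C\Delta t^2A^2]U^\star$, with $A=A_{h,\delta}$; they give $U^{n+1}=R(\Delta tA_{h,\delta})U^n$. *)

theory Defs
  imports
    "HOL-Analysis.Analysis"
    "HOL-Computational_Algebra.Computational_Algebra"
    "HOL-Computational_Algebra.Field_as_Ring"
begin

section \<open>Rational functions of a linear operator\<close>

definition poly_op :: "real poly \<Rightarrow> ('v::real_vector \<Rightarrow> 'v) \<Rightarrow> 'v \<Rightarrow> 'v" where
  "poly_op p M = (\<lambda>v. \<Sum>i\<le>degree p. coeff p i *\<^sub>R (M ^^ i) v)"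

text \<open>
  A rational function is an element of the field of fractions of the real polynomials, and
  \<^const>\<open>quot_of_fract\<close> is its numerator and denominator in lowest terms, so that its
  poles are the complex roots of the second component.
\<close>

definition ratfun_pole :: "real poly fract \<Rightarrow> complex \<Rightarrow> bool" where
  "ratfun_pole r z \<longleftrightarrow> poly (map_poly complex_of_real (snd (quot_of_fract r))) z = 0"

text \<open>
  Complex eigenvalues of a real operator are those of its complexification:
  the two equations are the real and imaginary parts of \<open>M (u + \<i> v) = z (u + \<i> v)\<close>.
\<close>

definition complex_eigenvalue :: "('v::real_vector \<Rightarrow> 'v) \<Rightarrow> complex \<Rightarrow> bool" where
  "complex_eigenvalue M z \<longleftrightarrow>
     (\<exists>u v. (u \<noteq> 0 \<or> v \<noteq> 0) \<and>
        M u = Re z *\<^sub>R u - Im z *\<^sub>R v \<and>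
        M v = Im z *\<^sub>R u + Re z *\<^sub>R v)"

definition no_eigenvalue_at_pole :: "real poly fract \<Rightarrow> ('v::real_vector \<Rightarrow> 'v) \<Rightarrow> bool" where
  "no_eigenvalue_at_pole r M \<longleftrightarrow> (\<forall>z. ratfun_pole r z \<longrightarrow> \<not> complex_eigenvalue M z)"

text \<open>
  The value is meaningful when \<^const>\<open>no_eigenvalue_at_pole\<close> holds and \<open>M\<close> is a linear operator on
  a finite-dimensional space; the denominator is then a bijective function of \<open>M\<close>.
\<close>

definition ratfun_op :: "real poly fract \<Rightarrow> ('v::real_vector \<Rightarrow> 'v) \<Rightarrow> 'v \<Rightarrow> 'v" where
  "ratfun_op r M =
     poly_op (fst (quot_of_fract r)) M \<circ> inv (poly_op (snd (quot_of_fract r)) M)"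


section \<open>The time method\<close>

definition C_minus :: real where "C_minus = (25 - sqrt 105) / 780"
definition C_plus :: real where "C_plus = (25 + sqrt 105) / 780"

definition a0 :: "real \<Rightarrow> real" where "a0 C = 1/6 + 7/2 * C"
definition a1 :: "real \<Rightarrow> real" where "a1 C = 2/3 - 10 * C"
definition a2 :: "real \<Rightarrow> real" where "a2 C = 1/6 + 13/2 * C"

abbreviation cst :: "real \<Rightarrow> real poly fract" where "cst c \<equiv> to_fract [:c:]"

text \<open>The indeterminate of the field of rational functions.\<close>

abbreviation Z :: "real poly fract" where "Z \<equiv> to_fract [:0, 1:]"

definition H_fun :: "real poly fract" where
  "H_fun = (1 + cst (1/4) * Z + cst (1/48) * Z^2) / (1 - cst (1/4) * Z + cst (1/48) * Z^2)"

definition R_fun :: "real \<Rightarrow> real poly fract" where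
  "R_fun C =
     (1 + cst (a0 C) * Z + cst C * Z^2 + (cst (a1 C) * Z - cst C * Z^2) * H_fun) /
     (1 - cst (a2 C) * Z + cst (3/2 * C) * Z^2)"

text \<open>
  In the two stages \<open>A\<close> gives the first time derivative and the closure \<open>Gc\<close> the second one;
  the closure is exact when \<open>Gc U = A (A U)\<close>.
\<close>

definition stage1 ::
  "real \<Rightarrow> ('v::real_vector \<Rightarrow> 'v) \<Rightarrow> ('v \<Rightarrow> 'v) \<Rightarrow> 'v \<Rightarrow> 'v \<Rightarrow> bool" where
  "stage1 \<Delta>t A Gc U Us \<longleftrightarrow>
     Us - (\<Delta>t / 4) *\<^sub>R A Us + (\<Delta>t\<^sup>2 / 48) *\<^sub>R Gc Us =
     U + (\<Delta>t / 4) *\<^sub>R A U + (\<Delta>t\<^sup>2 / 48) *\<^sub>R Gc U"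

definition stage2 ::
  "real \<Rightarrow> real \<Rightarrow> ('v::real_vector \<Rightarrow> 'v) \<Rightarrow> ('v \<Rightarrow> 'v) \<Rightarrow> 'v \<Rightarrow> 'v \<Rightarrow> 'v \<Rightarrow> bool" where
  "stage2 C \<Delta>t A Gc U Us U' \<longleftrightarrow>
     U' - (a2 C * \<Delta>t) *\<^sub>R A U' + (3/2 * C * \<Delta>t\<^sup>2) *\<^sub>R Gc U' =
     (U + (a0 C * \<Delta>t) *\<^sub>R A U + (C * \<Delta>t\<^sup>2) *\<^sub>R Gc U) +
     ((a1 C * \<Delta>t) *\<^sub>R A Us - (C * \<Delta>t\<^sup>2) *\<^sub>R Gc Us)"


section \<open>The relaxation system and its diffusion limit\<close>

definition A_op ::
  "real \<Rightarrow> ('x::real_inner \<Rightarrow> 'q::real_inner) \<Rightarrow> ('q \<Rightarrow> 'x) \<Rightarrow> real \<Rightarrow> 'x \<times> 'q \<Rightarrow> 'x \<times> 'q" where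
  "A_op a G D \<delta> = (\<lambda>(u, q). (- D q, - (a / \<delta>) *\<^sub>R G u - (1 / \<delta>) *\<^sub>R q))"

definition L_op :: "real \<Rightarrow> ('x::real_inner \<Rightarrow> 'q::real_inner) \<Rightarrow> 'x \<Rightarrow> 'x" where
  "L_op a G = (\<lambda>u. - a *\<^sub>R adjoint G (G u))"

definition P_op :: "'x \<times> 'q \<Rightarrow> 'x" where
  "P_op U = fst U"

definition E_op :: "real \<Rightarrow> ('x::real_inner \<Rightarrow> 'q::real_inner) \<Rightarrow> 'x \<Rightarrow> 'x \<times> 'q" where
  "E_op a G u = (u, - a *\<^sub>R G u)"

end

theory Submission
  imports Defs
begin

text \<open>
  The operator \<open>A\<close> is dissipative for the energy \<open>a \<bar>u\<bar>\<^sup>2 + \<delta> \<bar>q\<bar>\<^sup>2\<close>, and \<open>L = - a G\<^sup>* G\<close> is dissipative for the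
  inner product, while all poles of \<open>R\<close> lie in the open right half plane; hence all stage operators
  are invertible. Since \<open>R\<close> vanishes at infinity, \<open>R(M)\<close> is a polynomial without
  constant term in \<open>Q(M)\<^sup>-\<^sup>1\<close> and \<open>M Q(M)\<^sup>-\<^sup>1\<close> for the two quadratic factors \<open>Q = 1 - b z + c z\<^sup>2\<close> of its
  denominator. Because \<open>P E = 1\<close>, the approximation \<open>F \<delta> = E f P + O(\<delta>)\<close> is stable under sums and
  products, so that it is enough to prove it for these resolvents. There \<open>\<delta>\<close> enters only as a factor
  of the right-hand side of a fixed invertible linear system.
\<close>

subsection \<open>Finite-dimensional inner product spaces\<close>

text \<open>A predicate on a type, because \<open>X_h\<close> and \<open>Q_h\<close> are arbitrary
  inner product spaces and the property has to pass to their products.\<close>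

definition fin_dim :: "'a::real_vector itself \<Rightarrow> bool" where
  "fin_dim _ \<longleftrightarrow> (\<exists>B::'a set. finite B \<and> span B = UNIV)"

lemma fin_dim_prod:
  assumes "fin_dim TYPE('a::real_vector)" "fin_dim TYPE('b::real_vector)"
  shows "fin_dim TYPE('a::real_vector \<times> 'b::real_vector)"
proof -
  obtain A :: "'a set" and B :: "'b set"
    where A: "finite A" "span A = UNIV" and B: "finite B" "span B = UNIV"
    using assms unfolding fin_dim_def by blast
  let ?l = "\<lambda>x::'a. (x, 0::'b)" and ?r = "\<lambda>y::'b. (0::'a, y)"
  have l: "linear ?l" and r: "linear ?r"
    by (auto intro!: linearI)
  let ?C = "?l ` A \<union> ?r ` B"
  have "(x, y) \<in> span ?C" for x y
  proof -
    have "?l x \<in> span (?l ` A)" "?r y \<in> span (?r ` B)"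
      using A(2) B(2) by (simp_all add: span_linear_image[OF l] span_linear_image[OF r])
    then have "?l x \<in> span ?C" "?r y \<in> span ?C"
      using span_mono[of _ ?C] by blast+
    then have "?l x + ?r y \<in> span ?C" by (rule span_add)
    then show ?thesis by simp
  qed
  then have "span ?C = UNIV" by auto
  moreover have "finite ?C" using A(1) B(1) by simp
  ultimately show ?thesis unfolding fin_dim_def by blast
qed

text \<open>Gram-Schmidt gives an orthogonal spanning set. The difference between \<open>x\<close>
  and its expansion is orthogonal to this set, hence to itself. The set may contain 0, whose term
  vanishes.\<close>

lemma fin_dim_orthogonal_expansion:
  assumes "fin_dim TYPE('a::real_inner)"
  obtains B :: "'a::real_inner set"
  where "finite B" "\<And>x. x = (\<Sum>b\<in>B. ((x \<bullet> b) / (b \<bullet> b)) *\<^sub>R b)"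
proof -
  obtain A :: "'a set" where A: "finite A" "span A = UNIV"
    using assms unfolding fin_dim_def by blast
  obtain B :: "'a set" where B: "finite B" "span B = UNIV" "pairwise orthogonal B"
    using basis_orthogonal[OF A(1)] A(2) by auto
  have "x = (\<Sum>b\<in>B. ((x \<bullet> b) / (b \<bullet> b)) *\<^sub>R b)" for x
  proof -
    let ?y = "x - (\<Sum>b\<in>B. ((x \<bullet> b) / (b \<bullet> b)) *\<^sub>R b)"
    have "orthogonal ?y c" if "c \<in> B" for c
    proof -
      have "(\<Sum>b\<in>B. ((x \<bullet> b) / (b \<bullet> b)) *\<^sub>R b) \<bullet> c = (\<Sum>b\<in>B. if b = c then x \<bullet> c else 0)"
        unfolding inner_sum_left
      proof (rule sum.cong)
        fix b assume "b \<in> B"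
        then have "b \<noteq> c \<Longrightarrow> b \<bullet> c = 0"
          using B(3) that by (auto simp: pairwise_def orthogonal_def)
        then show "(((x \<bullet> b) / (b \<bullet> b)) *\<^sub>R b) \<bullet> c = (if b = c then x \<bullet> c else 0)" by auto
      qed simp
      also have "\<dots> = x \<bullet> c" using B(1) that by simp
      finally show ?thesis by (simp add: orthogonal_def inner_diff_left)
    qed
    then have "orthogonal ?y ?y"
      using B(2) orthogonal_to_span[of ?y B ?y] by simp
    then show ?thesis by (simp add: orthogonal_self)
  qed
  with B(1) show thesis using that by blast
qed

text \<open>The orthogonal expansion writes \<open>f\<close> as a finite sum of bounded rank-one
  maps.\<close>

lemma fin_dim_bounded_linear:
  fixes f :: "'a::real_inner \<Rightarrow> 'b::real_normed_vector"
  assumes "fin_dim TYPE('a)" "linear f"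
  shows "bounded_linear f"
proof -
  obtain B :: "'a set" where B: "finite B" "\<And>x. x = (\<Sum>b\<in>B. ((x \<bullet> b) / (b \<bullet> b)) *\<^sub>R b)"
    using fin_dim_orthogonal_expansion[OF assms(1)] by blast
  have "f x = (\<Sum>b\<in>B. ((x \<bullet> b) / (b \<bullet> b)) *\<^sub>R f b)" for x
    by (subst B(2)[of x]) (simp add: linear_sum[OF assms(2)] linear_cmul[OF assms(2)])
  then have "f = (\<lambda>x. \<Sum>b\<in>B. ((x \<bullet> b) / (b \<bullet> b)) *\<^sub>R f b)" by blast
  moreover have "bounded_linear (\<lambda>x. \<Sum>b\<in>B. ((x \<bullet> b) / (b \<bullet> b)) *\<^sub>R f b)"
    by (intro bounded_linear_sum bounded_linear_scaleR_const
        bounded_linear_compose[OF bounded_linear_divide] bounded_linear_inner_left)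
  ultimately show ?thesis by simp
qed

text \<open>\<open>adjoint\<close> is a choice operator, so a concrete adjoint \<open>g\<close> is
  built from the expansion and identified with it by uniqueness.\<close>

lemma fin_dim_adjoint_works:
  fixes f :: "'a::real_inner \<Rightarrow> 'b::real_inner"
  assumes "fin_dim TYPE('a)" "linear f"
  shows "f x \<bullet> y = x \<bullet> adjoint f y"
proof -
  obtain B :: "'a set" where B: "finite B" "\<And>x. x = (\<Sum>b\<in>B. ((x \<bullet> b) / (b \<bullet> b)) *\<^sub>R b)"
    using fin_dim_orthogonal_expansion[OF assms(1)] by blast
  define g where "g y = (\<Sum>b\<in>B. ((f b \<bullet> y) / (b \<bullet> b)) *\<^sub>R b)" for y
  have "f x \<bullet> y = x \<bullet> g y" for x y
    by (subst B(2)[of x])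
      (simp add: g_def linear_sum[OF assms(2)] linear_cmul[OF assms(2)] inner_sum_left
        inner_sum_right ac_simps)
  then have "adjoint f = g" by (intro adjoint_unique) blast
  with \<open>f x \<bullet> y = x \<bullet> g y\<close> show ?thesis by simp
qed

text \<open>A finite spanning set contains a basis, which gives an instance of
  \<open>finite_dimensional_vector_space\<close>; there injective endomorphisms are
  surjective.\<close>

lemma fin_dim_inj_imp_bij:
  fixes f :: "'a::real_vector \<Rightarrow> 'a"
  assumes "fin_dim TYPE('a)" "linear f" "inj f"
  shows "bij f"
proof -
  obtain A :: "'a set" where A: "finite A" "span A = UNIV"
    using assms unfolding fin_dim_def by blast
  obtain B where B: "B \<subseteq> A" "independent B" "A \<subseteq> span B"
    using maximal_independent_subset[of A] by blast
  have "span B = UNIV" using span_mono[OF B(3)] A(2) by (simp add: span_span top.extremum_unique)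
  moreover have "finite B" using A(1) B(1) finite_subset by blast
  ultimately interpret finite_dimensional_vector_space "scaleR :: real \<Rightarrow> 'a \<Rightarrow> 'a" B
    using B(2) by unfold_locales (auto simp: dependent_raw_def span_raw_def)
  have "surj f" using linear_inj_imp_surj assms(2,3) unfolding linear_def by blast
  with assms(3) show ?thesis by (simp add: bij_def)
qed

lemma linear_inv:
  fixes f :: "'a::real_vector \<Rightarrow> 'b::real_vector"
  assumes "linear f" "bij f"
  shows "linear (inv f)"
proof (rule linearI)
  have *: "f (inv f z) = z" "inv f (f w) = w" for z w
    using assms(2) by (simp_all add: bij_is_surj surj_f_inv_f bij_is_inj)
  show "inv f (x + y) = inv f x + inv f y" for x y
    by (metis * linear_add[OF assms(1)])
  show "inv f (c *\<^sub>R x) = c *\<^sub>R inv f x" for c x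
    by (metis * linear_cmul[OF assms(1)])
qed

text \<open>\<open>\<kappa>\<close> bounds the inverse. In \<open>resolvent_estimate\<close> this
  turns a small residual into a small error.\<close>

lemma fin_dim_bounded_below:
  fixes f :: "'a::real_inner \<Rightarrow> 'a"
  assumes "fin_dim TYPE('a)" "linear f" "inj f"
  obtains \<kappa> where "\<kappa> > 0" "\<And>x. norm x \<le> \<kappa> * norm (f x)"
proof -
  have "bij f" by (rule fin_dim_inj_imp_bij[OF assms])
  then have "bounded_linear (inv f)"
    by (intro fin_dim_bounded_linear linear_inv assms)
  then obtain \<kappa> where "\<kappa> > 0" and \<kappa>: "\<And>y. norm (inv f y) \<le> norm y * \<kappa>"
    using bounded_linear.pos_bounded by blast
  from \<kappa>[of "f x" for x] have "norm x \<le> \<kappa> * norm (f x)" for x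
    using assms(3) by (simp add: mult.commute)
  with \<open>\<kappa> > 0\<close> show thesis using that by blast
qed


subsection \<open>Polynomials and rational functions of an operator\<close>

lemma poly_op_eq_sum:
  assumes "degree p \<le> n"
  shows "poly_op p M v = (\<Sum>i\<le>n. coeff p i *\<^sub>R (M ^^ i) v)"
  unfolding poly_op_def using assms
  by (intro sum.mono_neutral_left) (auto simp: coeff_eq_0)

lemma poly_op_0 [simp]: "poly_op 0 M v = 0"
  by (simp add: poly_op_def)

lemma poly_op_pCons [simp]:
  assumes "linear M"
  shows "poly_op (pCons c p) M v = c *\<^sub>R v + M (poly_op p M v)"
proof -
  have "poly_op (pCons c p) M v = (\<Sum>i\<le>Suc (degree p). coeff (pCons c p) i *\<^sub>R (M ^^ i) v)"
    by (rule poly_op_eq_sum) (rule degree_pCons_le)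
  also have "\<dots> = c *\<^sub>R v + (\<Sum>i\<le>degree p. coeff p i *\<^sub>R M ((M ^^ i) v))"
    by (simp only: sum.atMost_Suc_shift) simp
  also have "(\<Sum>i\<le>degree p. coeff p i *\<^sub>R M ((M ^^ i) v)) = M (poly_op p M v)"
    by (simp add: poly_op_def linear_sum[OF assms] linear_cmul[OF assms])
  finally show ?thesis .
qed

lemma poly_op_add:
  assumes "linear M"
  shows "poly_op (p + q) M v = poly_op p M v + poly_op q M v"
  by (induction p q rule: poly_induct2)
    (simp_all add: assms linear_add[OF assms] scaleR_add_left)

lemma poly_op_smult:
  assumes "linear M"
  shows "poly_op (smult c p) M v = c *\<^sub>R poly_op p M v"
  by (induction p) (simp_all add: assms linear_cmul[OF assms] scaleR_add_right)

lemma poly_op_mult: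
  assumes "linear M"
  shows "poly_op (p * q) M v = poly_op p M (poly_op q M v)"
  by (induction p)
    (simp_all add: assms poly_op_add[OF assms] poly_op_smult[OF assms])

lemma linear_poly_op:
  assumes "linear M"
  shows "linear (poly_op p M)"
proof (induction p)
  case 0
  show ?case by (auto intro!: linearI)
next
  case (pCons c p)
  show ?case
    by (rule linearI)
      (simp_all add: assms linear_add[OF assms] linear_cmul[OF assms] linear_add[OF pCons(2)]
        linear_cmul[OF pCons(2)] algebra_simps)
qed

text \<open>With \<open>n / d\<close> the reduced form, \<open>n * q = p * d\<close> and coprimality
  force \<open>d dvd q\<close>; the quotient is the cancelled factor.\<close>

lemma quot_of_fract_cancel:
  fixes p q :: "real poly"
  assumes "q \<noteq> 0"
  obtains k where "p = fst (quot_of_fract (Fract p q)) * k" "q = snd (quot_of_fract (Fract p q)) * k"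
proof -
  define n d where "n = fst (quot_of_fract (Fract p q))" and "d = snd (quot_of_fract (Fract p q))"
  have d: "d \<noteq> 0" by (simp add: d_def)
  have "Fract n d = Fract p q" by (simp add: n_def d_def)
  then have eq: "n * q = p * d" using assms d by (simp add: eq_fract)
  moreover have "coprime n d" by (simp add: n_def d_def coprime_quot_of_fract)
  ultimately have "d dvd q"
    by (metis coprime_commute coprime_dvd_mult_right_iff dvd_triv_right)
  then obtain k where k: "q = d * k" by (elim dvdE)
  with eq d have "p = n * k" by (simp add: ac_simps)
  with k show thesis using that unfolding n_def d_def by blast
qed

text \<open>Makes \<open>ratfun_op\<close> computable from an unreduced fraction. The cancelled
  factor \<open>k\<close> divides \<open>q\<close>, so \<open>k(M)\<close> is injective along with
  \<open>q(M)\<close> and can be removed from both sides.\<close>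

lemma ratfun_op_eqI:
  fixes M :: "'v::real_vector \<Rightarrow> 'v"
  assumes "linear M" "q \<noteq> 0" "bij (poly_op q M)" "poly_op q M v = poly_op p M u"
  shows "ratfun_op (Fract p q) M u = v"
proof -
  define n d where "n = fst (quot_of_fract (Fract p q))" and "d = snd (quot_of_fract (Fract p q))"
  obtain k where k: "p = k * n" "q = k * d"
    using quot_of_fract_cancel[OF assms(2), of p] unfolding n_def d_def by (metis mult.commute)
  have q: "poly_op q M w = poly_op k M (poly_op d M w)"
    "poly_op q M w = poly_op d M (poly_op k M w)" for w
    by (simp_all add: k poly_op_mult[OF assms(1), symmetric] mult.commute)
  have "inj (poly_op k M)" "inj (poly_op d M)"
    using bij_is_inj[OF assms(3)] q by (metis injI inj_eq)+
  moreover have "surj (poly_op d M)"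
    using bij_is_surj[OF assms(3)] q(2) by (metis surj_def)
  ultimately have d: "bij (poly_op d M)" by (simp add: bij_def)
  have "poly_op k M (poly_op d M v) = poly_op k M (poly_op n M u)"
    using assms(4) by (simp add: k poly_op_mult[OF assms(1)])
  then have "poly_op d M v = poly_op n M u"
    using \<open>inj (poly_op k M)\<close> by (simp add: inj_eq)
  also have "\<dots> = poly_op n M (poly_op d M (inv (poly_op d M) u))"
    using d by (simp add: bij_is_surj surj_f_inv_f)
  also have "\<dots> = poly_op d M (poly_op n M (inv (poly_op d M) u))"
    by (simp add: poly_op_mult[OF assms(1), symmetric] mult.commute)
  finally have "v = poly_op n M (inv (poly_op d M) u)"
    using \<open>inj (poly_op d M)\<close> by (simp add: inj_eq)
  then show ?thesis by (simp add: ratfun_op_def n_def d_def)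
qed

lemma map_poly_of_real_mult:
  "map_poly complex_of_real (p * q) = map_poly complex_of_real p * map_poly complex_of_real q"
  by (simp add: poly_eq_iff coeff_map_poly coeff_mult)

text \<open>Only this direction holds: a root of \<open>q\<close> may disappear when the fraction is
  reduced.\<close>

lemma ratfun_pole_Fract_imp:
  assumes "q \<noteq> 0" "ratfun_pole (Fract p q) z"
  shows "poly (map_poly complex_of_real q) z = 0"
proof -
  obtain k where "q = snd (quot_of_fract (Fract p q)) * k"
    using quot_of_fract_cancel[OF assms(1)] by blast
  with assms(2) show ?thesis
    unfolding ratfun_pole_def by (metis map_poly_of_real_mult mult_zero_left poly_mult)
qed


subsection \<open>Dissipative operators\<close>

text \<open>The inner product \<open>e\<close> is existentially quantified because the energy suited
  to the relaxation operator depends on \<delta>.\<close>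

definition dissipative :: "('v::real_vector \<Rightarrow> 'v) \<Rightarrow> bool" where
  "dissipative M \<longleftrightarrow> (\<exists>e::'v \<Rightarrow> 'v \<Rightarrow> real. bilinear e \<and> (\<forall>x y. e x y = e y x) \<and>
     (\<forall>x. x \<noteq> 0 \<longrightarrow> e x x > 0) \<and> (\<forall>x. e x (M x) \<le> 0))"

text \<open>For an eigenvector \<open>u + i v\<close>, the mixed terms of
  \<open>e u (M u) + e v (M v)\<close> cancel by symmetry, leaving \<open>Re z\<close> times a
  positive number.\<close>

lemma dissipative_eigenvalue:
  fixes M :: "'v::real_vector \<Rightarrow> 'v"
  assumes "dissipative M" "complex_eigenvalue M z"
  shows "Re z \<le> 0"
proof -
  obtain e :: "'v \<Rightarrow> 'v \<Rightarrow> real" where e: "bilinear e" "\<And>x y. e x y = e y x" "\<And>x. x \<noteq> 0 \<Longrightarrow> e x x > 0"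
      "\<And>x. e x (M x) \<le> 0"
    using assms(1) unfolding dissipative_def by blast
  obtain u v where uv: "u \<noteq> 0 \<or> v \<noteq> 0" "M u = Re z *\<^sub>R u - Im z *\<^sub>R v"
      "M v = Im z *\<^sub>R u + Re z *\<^sub>R v"
    using assms(2) unfolding complex_eigenvalue_def by blast
  have "e u (M u) = Re z * e u u - Im z * e u v" "e v (M v) = Im z * e u v + Re z * e v v"
    using e(2)[of v u]
    by (simp_all add: uv(2,3) bilinear_radd[OF e(1)] bilinear_rsub[OF e(1)] bilinear_rmul[OF e(1)])
  then have "Re z * (e u u + e v v) \<le> 0" using e(4)[of u] e(4)[of v] by (simp add: distrib_left)
  moreover have nonneg: "e x x \<ge> 0" for x
    using e(3)[of x] bilinear_lzero[OF e(1), of x] by (cases "x = 0") auto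
  have "e u u + e v v > 0"
    using uv(1) e(3)[of u] e(3)[of v] nonneg[of u] nonneg[of v] by (auto intro: add_pos_nonneg add_nonneg_pos)
  ultimately show ?thesis by (simp add: mult_le_0_iff)
qed

text \<open>With this sign both stage denominators have positive parameters; the numerator of
  \<open>H_fun\<close> is \<open>quad (- 1/4) (1/48)\<close>.\<close>

abbreviation quad :: "real \<Rightarrow> real \<Rightarrow> real poly" where
  "quad b c \<equiv> [:1, - b, c:]"

lemma poly_op_quad:
  assumes "linear M"
  shows "poly_op (quad b c) M v = v - b *\<^sub>R M v + c *\<^sub>R M (M v)"
  by (simp add: assms linear_diff[OF assms] linear_add[OF assms] linear_cmul[OF assms]
      linear_0[OF assms])

text \<open>A real root satisfies \<open>b z = 1 + c z^2 > 0\<close>; a nonreal root has real part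
  \<open>b / (2 c)\<close>.\<close>

lemma quad_root_Re_pos:
  assumes "b > 0" "c > 0" "poly (map_poly complex_of_real (quad b c)) z = 0"
  shows "Re z > 0"
proof -
  have "1 - of_real b * z + of_real c * z\<^sup>2 = 0"
    using assms(2,3) by (simp add: map_poly_pCons algebra_simps power2_eq_square)
  from arg_cong[OF this, of Re] arg_cong[OF this, of Im]
  have re: "1 - b * Re z + c * ((Re z)\<^sup>2 - (Im z)\<^sup>2) = 0" and im: "Im z * (2 * c * Re z - b) = 0"
    by (simp_all add: power2_eq_square algebra_simps)
  show ?thesis
  proof (cases "Im z = 0")
    case True
    with re assms(2) have "b * Re z > 0"
      by (smt (verit) mult_nonneg_nonneg zero_le_power2 zero_eq_power2 power_zero_numeral)
    with assms(1) show ?thesis by (simp add: zero_less_mult_iff)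
  next
    case False
    with im have "2 * c * Re z = b" by simp
    with assms(1,2) show ?thesis by (metis zero_less_mult_pos mult_pos_pos zero_less_numeral)
  qed
qed

text \<open>Pairing \<open>x - b M x + c M (M x) = 0\<close> with \<open>M x\<close> in the energy form leaves only nonpositive
  terms, so that \<open>M x = 0\<close>.\<close>

lemma bij_poly_op_quad:
  fixes M :: "'v::real_vector \<Rightarrow> 'v"
  assumes "fin_dim TYPE('v)" "linear M" "dissipative M" "b > 0" "c > 0"
  shows "bij (poly_op (quad b c) M)"
proof -
  obtain e :: "'v \<Rightarrow> 'v \<Rightarrow> real" where e: "bilinear e" "\<And>x y. e x y = e y x" "\<And>x. x \<noteq> 0 \<Longrightarrow> e x x > 0"
      "\<And>x. e x (M x) \<le> 0"
    using assms(3) unfolding dissipative_def by blast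
  have "x = 0" if "poly_op (quad b c) M x = 0" for x
  proof -
    have *: "x - b *\<^sub>R M x + c *\<^sub>R M (M x) = 0" using that by (simp only: poly_op_quad[OF assms(2)])
    have "e (M x) (x - b *\<^sub>R M x + c *\<^sub>R M (M x)) = 0"
      unfolding * by (rule bilinear_rzero[OF e(1)])
    then have "e x (M x) - b * e (M x) (M x) + c * e (M x) (M (M x)) = 0"
      using e(2)[of x "M x"]
      by (simp add: bilinear_radd[OF e(1)] bilinear_rsub[OF e(1)] bilinear_rmul[OF e(1)])
    moreover have "c * e (M x) (M (M x)) \<le> 0" using e(4)[of "M x"] assms(5) by (simp add: mult_le_0_iff)
    ultimately have "b * e (M x) (M x) \<le> 0" using e(4)[of x] by linarith
    then have "e (M x) (M x) \<le> 0" using assms(4) by (simp add: mult_le_0_iff)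
    then have "M x = 0" using e(3)[of "M x"] by fastforce
    with * show "x = 0" by (simp add: linear_0[OF assms(2)])
  qed
  then have "inj (poly_op (quad b c) M)"
    using linear_injective_0 linear_poly_op[OF assms(2)] by blast
  then show ?thesis by (intro fin_dim_inj_imp_bij assms linear_poly_op)
qed


subsection \<open>The stability function of the method\<close>

text \<open>The numerator after clearing the denominator of \<open>H_fun\<close>, not necessarily in
  lowest terms. The contributions \<open>C/48\<close> and \<open>- C/48\<close> to the fourth-degree
  coefficient cancel, which is why \<open>R\<close> vanishes at infinity.\<close>

definition R_num :: "real \<Rightarrow> real poly" where
  "R_num C = [:1, a0 C, C:] * quad (1/4) (1/48) + [:0, a1 C, - C:] * quad (- 1/4) (1/48)"

definition R_den :: "real \<Rightarrow> real poly" where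
  "R_den C = quad (1/4) (1/48) * quad (a2 C) (3/2 * C)"

lemma R_fun_eq_Fract: "R_fun C = Fract (R_num C) (R_den C)"
proof -
  \<comment> \<open>Brings embedded quadratics into the shape used in \<open>H_fun\<close> and
    \<open>R_fun\<close>.\<close>
  have lin: "to_fract [:x, y, z:] = cst x + cst y * Z + cst z * Z^2" for x y z
  proof -
    have "[:x, y, z:] = [:x:] + [:y:] * [:0, 1:] + [:z:] * ([:0, 1:] * [:0, 1:])" by simp
    then show ?thesis by (simp only: to_fract_add to_fract_mult power2_eq_square)
  qed
  have neg: "cst (- x) = - cst x" for x
    by (simp only: to_fract_uminus [symmetric]) simp
  have one: "cst 1 = 1" and zero: "cst 0 = 0" by (simp_all flip: one_pCons)
  define q1 q2 p1 :: "real poly fract" where "q1 = to_fract (quad (1/4) (1/48))"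
    and "q2 = to_fract (quad (a2 C) (3/2 * C))" and "p1 = to_fract (quad (- 1/4) (1/48))"
  have "q1 \<noteq> 0" "q2 \<noteq> 0" by (simp_all add: q1_def q2_def)
  have "H_fun = p1 / q1"
    unfolding H_fun_def p1_def q1_def lin neg one by (simp add: neg flip: minus_divide_left)
  then have "R_fun C = (to_fract [:1, a0 C, C:] + to_fract [:0, a1 C, - C:] * (p1 / q1)) / q2"
    unfolding R_fun_def q2_def lin neg one zero by simp
  also have "\<dots> = (to_fract [:1, a0 C, C:] * q1 + to_fract [:0, a1 C, - C:] * p1) / (q1 * q2)"
    using \<open>q1 \<noteq> 0\<close> \<open>q2 \<noteq> 0\<close> by (simp add: field_simps)
  also have "\<dots> = Fract (R_num C) (R_den C)"
    by (simp only: Fract_conv_to_fract R_num_def R_den_def to_fract_add to_fract_mult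
        q1_def q2_def p1_def)
  finally show ?thesis .
qed

lemma R_den_nonzero: "R_den C \<noteq> 0"
  by (simp add: R_den_def)

text \<open>\<open>C_minus\<close> is positive because \<open>105 < 25^2\<close>. Positivity of
  \<open>C\<close> makes the parameters of the second stage denominator positive.\<close>

lemma C_pos:
  assumes "C \<in> {C_minus..C_plus}"
  shows "C > 0"
proof -
  have "sqrt 105 < 25" by (rule real_less_lsqrt) simp_all
  with assms show ?thesis by (simp add: C_minus_def)
qed

lemma a2_pos: "C > 0 \<Longrightarrow> a2 C > 0"
  by (simp add: a2_def)

context
  fixes M :: "'v::real_vector \<Rightarrow> 'v" and C :: real
  assumes fin: "fin_dim TYPE('v)" and M: "linear M" and diss: "dissipative M" and C: "C > 0"
begin

text \<open>Poles are roots of one of the two quadratics and have positive real part, whereas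
  eigenvalues of \<open>M\<close> have nonpositive real part.\<close>

lemma no_eigenvalue_at_pole_R_fun: "no_eigenvalue_at_pole (R_fun C) M"
  unfolding no_eigenvalue_at_pole_def
proof (intro allI impI notI)
  fix z assume "ratfun_pole (R_fun C) z" and ev: "complex_eigenvalue M z"
  then have "poly (map_poly complex_of_real (R_den C)) z = 0"
    unfolding R_fun_eq_Fract by (intro ratfun_pole_Fract_imp R_den_nonzero)
  then have "poly (map_poly complex_of_real (quad (1/4) (1/48))) z = 0 \<or>
      poly (map_poly complex_of_real (quad (a2 C) (3/2 * C))) z = 0"
    unfolding R_den_def map_poly_of_real_mult by simp
  then have "Re z > 0"
    using quad_root_Re_pos[of "1/4" "1/48" z] quad_root_Re_pos[of "a2 C" "3/2 * C" z] C a2_pos[OF C]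
    by fastforce
  with dissipative_eigenvalue[OF diss ev] show False by simp
qed

lemma bij_poly_op_factors:
  "bij (poly_op (quad (1/4) (1/48)) M)" "bij (poly_op (quad (a2 C) (3/2 * C)) M)"
  by (rule bij_poly_op_quad[OF fin M diss]; use C a2_pos[OF C] in simp)+

lemma bij_poly_op_R_den: "bij (poly_op (R_den C) M)"
proof -
  have "poly_op (R_den C) M = poly_op (quad (1/4) (1/48)) M \<circ> poly_op (quad (a2 C) (3/2 * C)) M"
    unfolding R_den_def by (rule ext) (simp only: poly_op_mult[OF M] o_apply)
  then show ?thesis by (simp only: bij_comp bij_poly_op_factors)
qed

lemma ratfun_op_R_fun_eqI:
  assumes "poly_op (R_den C) M v = poly_op (R_num C) M u"
  shows "ratfun_op (R_fun C) M u = v"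
  unfolding R_fun_eq_Fract by (rule ratfun_op_eqI[OF M R_den_nonzero bij_poly_op_R_den assms])

text \<open>Elimination of the intermediate stage: the first denominator, applied to the second
  stage equation, commutes past the coefficient of \<open>us\<close>, and the first stage equation
  is then inserted.\<close>

lemma two_stages_eq_ratfun_op:
  assumes "poly_op (quad (1/4) (1/48)) M us = poly_op (quad (- 1/4) (1/48)) M u"
    and "poly_op (quad (a2 C) (3/2 * C)) M v = poly_op [:1, a0 C, C:] M u + poly_op [:0, a1 C, - C:] M us"
  shows "v = ratfun_op (R_fun C) M u"
proof -
  let ?q = "quad (1/4) (1/48)"
  have "poly_op (R_den C) M v = poly_op ?q M (poly_op [:1, a0 C, C:] M u + poly_op [:0, a1 C, - C:] M us)"
    unfolding R_den_def by (simp only: poly_op_mult[OF M] assms)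
  also have "\<dots> = poly_op ([:1, a0 C, C:] * ?q) M u + poly_op [:0, a1 C, - C:] M (poly_op ?q M us)"
    unfolding linear_add[OF linear_poly_op[OF M]]
    by (simp only: poly_op_mult[OF M, symmetric] mult.commute)
  also have "\<dots> = poly_op (R_num C) M u"
    by (simp only: assms R_num_def poly_op_add[OF M] poly_op_mult[OF M])
  finally show ?thesis using ratfun_op_R_fun_eqI by metis
qed

text \<open>Since \<open>R\<close> vanishes at infinity, it is a polynomial without constant term in the functions
  \<open>1/Q\<close> and \<open>z/Q\<close>, where \<open>Q\<close> runs through the two quadratic factors of the denominator.\<close>

lemma ratfun_op_R_fun_expansion:
  fixes S1 S2
  defines "S1 \<equiv> inv (poly_op (quad (1/4) (1/48)) M)"
    and "S2 \<equiv> inv (poly_op (quad (a2 C) (3/2 * C)) M)"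
  shows "ratfun_op (R_fun C) M u =
    (1 + 24 * a1 C) *\<^sub>R S2 u + (a0 C + a1 C - 24 * C) *\<^sub>R M (S2 u) +
    (- 24 * a1 C) *\<^sub>R S2 (S1 u) + (6 * a1 C) *\<^sub>R S2 (M (S1 u)) +
    (24 * C) *\<^sub>R M (S2 (S1 u)) + (- 6 * C) *\<^sub>R M (S2 (M (S1 u)))"
proof (rule ratfun_op_R_fun_eqI)
  let ?q1 = "quad (1/4) (1/48)" and ?q2 = "quad (a2 C) (3/2 * C)"
  \<comment> \<open>With \<open>s = u / (Q1 Q2)\<close>, every term of the expansion becomes a
    polynomial in \<open>M\<close> applied to \<open>s\<close>.\<close>
  define w s where "w = S1 u" and "s = S2 w"
  have inv1: "S1 (poly_op ?q1 M x) = x" and inv1': "poly_op ?q1 M (S1 x) = x"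
    and inv2: "S2 (poly_op ?q2 M x) = x" and inv2': "poly_op ?q2 M (S2 x) = x" for x
    unfolding S1_def S2_def using bij_poly_op_factors
    by (simp_all add: bij_is_inj bij_is_surj surj_f_inv_f del: poly_op_pCons)
  have M_poly: "M (poly_op p M x) = poly_op p M (M x)" for p x
    using poly_op_mult[OF M, of "[:0, 1:]" p x] poly_op_mult[OF M, of p "[:0, 1:]" x]
    by (simp add: M linear_0[OF M] mult.commute)
  have w: "w = poly_op ?q2 M s" by (simp only: s_def inv2')
  have u: "u = poly_op ?q1 M w" by (simp only: w_def inv1')
  have u': "u = poly_op ?q2 M (poly_op ?q1 M s)"
    unfolding u w by (simp only: poly_op_mult[OF M, symmetric] mult.commute)
  have S2u: "S2 u = poly_op ?q1 M s" unfolding u' by (rule inv2)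
  have S2Mw: "S2 (M w) = M s" unfolding w M_poly by (rule inv2)
  \<comment> \<open>The coefficients come from \<open>H = 1 + (z/2) / Q1\<close> and
    \<open>z^2 / Q1 = 48 + (12 z - 48) / Q1\<close>.\<close>
  let ?p = "smult (1 + 24 * a1 C) ?q1 + smult (a0 C + a1 C - 24 * C) ([:0, 1:] * ?q1) +
    [:- 24 * a1 C, 6 * a1 C + 24 * C, - 6 * C:]"
  have num: "?p = R_num C" by (simp add: R_num_def field_simps)
  have "(1 + 24 * a1 C) *\<^sub>R S2 u + (a0 C + a1 C - 24 * C) *\<^sub>R M (S2 u) +
    (- 24 * a1 C) *\<^sub>R S2 (S1 u) + (6 * a1 C) *\<^sub>R S2 (M (S1 u)) +
    (24 * C) *\<^sub>R M (S2 (S1 u)) + (- 6 * C) *\<^sub>R M (S2 (M (S1 u))) = poly_op ?p M s" (is "?v = _")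
    unfolding S2u w_def[symmetric] s_def[symmetric] S2Mw
    by (simp add: poly_op_add[OF M] poly_op_smult[OF M] M linear_0[OF M] linear_add[OF M]
        linear_diff[OF M] linear_cmul[OF M] algebra_simps)
  then have v: "?v = poly_op (R_num C) M s" unfolding num .
  have "u = poly_op (R_den C) M s"
    unfolding R_den_def u w by (simp only: poly_op_mult[OF M])
  then show "poly_op (R_den C) M ?v = poly_op (R_num C) M u"
    unfolding v by (simp only: poly_op_mult[OF M, symmetric] mult.commute)
qed

end


subsection \<open>First-order approximation of operator families\<close>

text \<open>A pointwise bound, so that compositions are estimated without a continuity proof for
  each \<open>F \<delta>\<close>. The constant \<open>K\<close> precedes the filter and thus serves
  all small \<delta>; its sign is left open.\<close>

definition first_order ::
  "('w::real_normed_vector \<Rightarrow> 'v) \<Rightarrow> ('v \<Rightarrow> 'w) \<Rightarrow> (real \<Rightarrow> 'w \<Rightarrow> 'w) \<Rightarrow> ('v \<Rightarrow> 'v) \<Rightarrow> bool" where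
  "first_order P E F f \<longleftrightarrow>
     (\<exists>K. \<forall>\<^sub>F \<delta> in at_right 0. \<forall>U. norm (F \<delta> U - E (f (P U))) \<le> K * \<delta> * norm U)"

lemma first_order_add:
  assumes "linear E" "first_order P E F f" "first_order P E G g"
  shows "first_order P E (\<lambda>\<delta> U. F \<delta> U + G \<delta> U) (\<lambda>u. f u + g u)"
proof -
  obtain K where K: "\<forall>\<^sub>F \<delta> in at_right 0. \<forall>U. norm (F \<delta> U - E (f (P U))) \<le> K * \<delta> * norm U"
    using assms(2) unfolding first_order_def by blast
  obtain L where L: "\<forall>\<^sub>F \<delta> in at_right 0. \<forall>U. norm (G \<delta> U - E (g (P U))) \<le> L * \<delta> * norm U"
    using assms(3) unfolding first_order_def by blast
  have "\<forall>\<^sub>F \<delta> in at_right 0. \<forall>U. norm (F \<delta> U + G \<delta> U - E (f (P U) + g (P U))) \<le> (K + L) * \<delta> * norm U"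
    using K L
  proof eventually_elim
    case (elim \<delta>)
    show ?case
    proof
      fix U
      have "F \<delta> U + G \<delta> U - E (f (P U) + g (P U)) = (F \<delta> U - E (f (P U))) + (G \<delta> U - E (g (P U)))"
        by (simp add: linear_add[OF assms(1)])
      also have "norm \<dots> \<le> K * \<delta> * norm U + L * \<delta> * norm U"
        using elim by (intro norm_triangle_mono) blast+
      finally show "norm (F \<delta> U + G \<delta> U - E (f (P U) + g (P U))) \<le> (K + L) * \<delta> * norm U"
        by (simp add: algebra_simps)
    qed
  qed
  then show ?thesis unfolding first_order_def by blast
qed

lemma first_order_scaleR:
  assumes "linear E" "first_order P E F f"
  shows "first_order P E (\<lambda>\<delta> U. c *\<^sub>R F \<delta> U) (\<lambda>u. c *\<^sub>R f u)"
proof -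
  obtain K where K: "\<forall>\<^sub>F \<delta> in at_right 0. \<forall>U. norm (F \<delta> U - E (f (P U))) \<le> K * \<delta> * norm U"
    using assms(2) unfolding first_order_def by blast
  have "\<forall>\<^sub>F \<delta> in at_right 0. \<forall>U. norm (c *\<^sub>R F \<delta> U - E (c *\<^sub>R f (P U))) \<le> (\<bar>c\<bar> * K) * \<delta> * norm U"
    using K
  proof eventually_elim
    case (elim \<delta>)
    show ?case
    proof
      fix U
      have "norm (c *\<^sub>R F \<delta> U - E (c *\<^sub>R f (P U))) = \<bar>c\<bar> * norm (F \<delta> U - E (f (P U)))"
        by (simp add: linear_cmul[OF assms(1)] flip: scaleR_diff_right)
      also have "\<dots> \<le> \<bar>c\<bar> * (K * \<delta> * norm U)" using elim by (intro mult_left_mono) auto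
      finally show "norm (c *\<^sub>R F \<delta> U - E (c *\<^sub>R f (P U))) \<le> (\<bar>c\<bar> * K) * \<delta> * norm U"
        by (simp add: ac_simps)
    qed
  qed
  then show ?thesis unfolding first_order_def by blast
qed

text \<open>From \<open>P E = 1\<close> follows
  \<open>F G - E f g P = (F - E f P) G + E f P (G - E g P)\<close>. The first term needs a bound on
  \<open>G \<delta>\<close> uniform in \<delta>.\<close>

lemma first_order_compose:
  assumes "bounded_linear P" "bounded_linear E" "bounded_linear f" "bounded_linear g"
    and "\<And>u. P (E u) = u"
    and "first_order P E F f" "first_order P E G g"
  shows "first_order P E (\<lambda>\<delta> U. F \<delta> (G \<delta> U)) (\<lambda>u. f (g u))"
proof -
  obtain K where K: "\<forall>\<^sub>F \<delta> in at_right 0. \<forall>U. norm (F \<delta> U - E (f (P U))) \<le> K * \<delta> * norm U"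
    using assms(6) unfolding first_order_def by blast
  obtain L where L: "\<forall>\<^sub>F \<delta> in at_right 0. \<forall>U. norm (G \<delta> U - E (g (P U))) \<le> L * \<delta> * norm U"
    using assms(7) unfolding first_order_def by blast
  have bf: "bounded_linear (\<lambda>U. E (f (P U)))" and bg: "bounded_linear (\<lambda>U. E (g (P U)))"
    by (intro bounded_linear_compose[OF assms(2)] bounded_linear_compose[OF assms(3)]
        bounded_linear_compose[OF assms(4)] assms(1))+
  obtain B where B: "B > 0" "\<And>U. norm (E (f (P U))) \<le> norm U * B"
    using bounded_linear.pos_bounded[OF bf] by blast
  obtain B' where B': "B' > 0" "\<And>U. norm (E (g (P U))) \<le> norm U * B'"
    using bounded_linear.pos_bounded[OF bg] by blast
  \<comment> \<open>The upper bound 1 yields the uniform bound \<open>\<bar>L\<bar> + B'\<close> for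
    \<open>G \<delta>\<close>.\<close>
  have small: "\<forall>\<^sub>F \<delta> in at_right (0::real). 0 < \<delta> \<and> \<delta> < 1"
    unfolding eventually_at_right_field by (intro exI[of _ 1]) simp
  have "\<forall>\<^sub>F \<delta> in at_right 0. \<forall>U. norm (F \<delta> (G \<delta> U) - E (f (g (P U))))
      \<le> (\<bar>K\<bar> * (\<bar>L\<bar> + B') + \<bar>L\<bar> * B) * \<delta> * norm U"
    using K L small
  proof eventually_elim
    case (elim \<delta>)
    show ?case
    proof
      fix U
      let ?d = "G \<delta> U - E (g (P U))"
      have d: "norm ?d \<le> \<bar>L\<bar> * \<delta> * norm U"
        using elim(2,3) by (smt (verit) mult_right_mono norm_ge_zero)
      have "norm (G \<delta> U) \<le> norm ?d + norm (E (g (P U)))"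
        using norm_triangle_ineq[of ?d "E (g (P U))"] by simp
      also have "\<dots> \<le> \<bar>L\<bar> * norm U + norm U * B'"
      proof (rule add_mono[OF _ B'(2)])
        have "\<bar>L\<bar> * \<delta> * norm U \<le> \<bar>L\<bar> * 1 * norm U"
          using elim(3) by (intro mult_right_mono mult_left_mono) auto
        with d show "norm ?d \<le> \<bar>L\<bar> * norm U" by simp
      qed
      finally have GU: "norm (G \<delta> U) \<le> (\<bar>L\<bar> + B') * norm U" by (simp add: algebra_simps)
      have "norm (F \<delta> (G \<delta> U) - E (f (P (G \<delta> U)))) \<le> K * \<delta> * norm (G \<delta> U)" using elim(1) by blast
      also have "\<dots> \<le> \<bar>K\<bar> * \<delta> * ((\<bar>L\<bar> + B') * norm U)"
        using elim(3) GU by (intro mult_mono) auto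
      finally have 1: "norm (F \<delta> (G \<delta> U) - E (f (P (G \<delta> U)))) \<le> \<bar>K\<bar> * \<delta> * ((\<bar>L\<bar> + B') * norm U)" .
      have "E (f (P (G \<delta> U))) - E (f (g (P U))) = E (f (P ?d))"
        using linear_diff[OF bounded_linear.linear[OF bf], of "G \<delta> U" "E (g (P U))"]
        by (simp add: assms(5))
      then have "norm (E (f (P (G \<delta> U))) - E (f (g (P U)))) \<le> norm ?d * B" using B(2) by simp
      also have "\<dots> \<le> \<bar>L\<bar> * \<delta> * norm U * B" using d B(1) by (intro mult_right_mono) auto
      finally have 2: "norm (E (f (P (G \<delta> U))) - E (f (g (P U)))) \<le> \<bar>L\<bar> * \<delta> * norm U * B" .
      have "norm (F \<delta> (G \<delta> U) - E (f (g (P U)))) \<le>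
          \<bar>K\<bar> * \<delta> * ((\<bar>L\<bar> + B') * norm U) + \<bar>L\<bar> * \<delta> * norm U * B"
        using norm_triangle_mono[OF 1 2] by simp
      then show "norm (F \<delta> (G \<delta> U) - E (f (g (P U)))) \<le>
          (\<bar>K\<bar> * (\<bar>L\<bar> + B') + \<bar>L\<bar> * B) * \<delta> * norm U"
        by (simp add: algebra_simps)
    qed
  qed
  then show ?thesis unfolding first_order_def by blast
qed


subsection \<open>The diffusion limit\<close>

locale relaxation =
  fixes G :: "'x::real_inner \<Rightarrow> 'q::real_inner" and D :: "'q \<Rightarrow> 'x" and a \<tau> :: real
  assumes fin_X: "fin_dim TYPE('x)" and fin_Q: "fin_dim TYPE('q)"
    and a_pos: "a > 0" and \<tau>_pos: "\<tau> > 0"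
    and linear_G: "linear G" and linear_D: "linear D"
    and D_eq: "D = (\<lambda>q. - adjoint G q)"
begin

abbreviation "M \<delta> \<equiv> (\<lambda>U. \<tau> *\<^sub>R A_op a G D \<delta> U)"
abbreviation "l \<equiv> (\<lambda>u. \<tau> *\<^sub>R L_op a G u)"
abbreviation "E \<equiv> E_op a G"

lemmas linear_GD_simps =
  linear_add[OF linear_G] linear_diff[OF linear_G] linear_cmul[OF linear_G] linear_neg[OF linear_G]
  linear_0[OF linear_G]
  linear_add[OF linear_D] linear_diff[OF linear_D] linear_cmul[OF linear_D] linear_neg[OF linear_D]
  linear_0[OF linear_D]

lemma inner_G: "G u \<bullet> q = - (u \<bullet> D q)"
  unfolding D_eq using fin_dim_adjoint_works[OF fin_X linear_G] by simp

lemma l_eq: "l u = (\<tau> * a) *\<^sub>R D (G u)"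
  by (simp add: L_op_def D_eq)

text \<open>Isolates the singular factor: it multiplies \<open>a G u + q\<close>, which vanishes
  exactly on the range of \<open>E\<close>.\<close>

lemma M_eq: "M \<delta> U = (- \<tau> *\<^sub>R D (snd U), - (\<tau> / \<delta>) *\<^sub>R (a *\<^sub>R G (fst U) + snd U))"
  by (cases U) (simp add: A_op_def algebra_simps)

lemma fin_XQ: "fin_dim TYPE('x \<times> 'q)"
  by (rule fin_dim_prod[OF fin_X fin_Q])

lemma linear_l: "linear l"
  unfolding l_eq by (rule linearI) (simp_all add: linear_GD_simps algebra_simps)

lemma linear_M: "linear (M \<delta>)"
  unfolding M_eq by (rule linearI) (simp_all add: linear_GD_simps algebra_simps)

lemma linear_E: "linear E"
  unfolding E_op_def by (rule linearI) (simp_all add: linear_GD_simps algebra_simps)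

lemma P_E: "P_op (E u) = u"
  by (simp add: P_op_def E_op_def)

lemma dissipative_l: "dissipative l"
proof -
  have "u \<bullet> l u \<le> 0" for u
  proof -
    have "u \<bullet> l u = - (\<tau> * a) * (G u \<bullet> G u)" by (simp add: l_eq inner_G[of u "G u"])
    then show ?thesis using a_pos \<tau>_pos by simp
  qed
  moreover have "bilinear ((\<bullet>) :: 'x \<Rightarrow> 'x \<Rightarrow> real)"
    unfolding bilinear_def by (auto intro!: linearI simp: inner_add_left inner_add_right)
  ultimately show ?thesis unfolding dissipative_def
    by (intro exI[of _ "(\<bullet>)"]) (simp add: inner_commute)
qed

text \<open>The weights \<open>a\<close> and \<delta> make the two coupling terms cancel through
  \<open>inner_G\<close>; what remains is \<open>- \<tau>\<close> times the squared norm of the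
  second component.\<close>

lemma dissipative_M:
  assumes "\<delta> > 0"
  shows "dissipative (M \<delta>)"
proof -
  define e :: "'x \<times> 'q \<Rightarrow> 'x \<times> 'q \<Rightarrow> real" where
    "e U V = a * (fst U \<bullet> fst V) + \<delta> * (snd U \<bullet> snd V)" for U V
  have "bilinear e"
    unfolding bilinear_def e_def
    by (auto intro!: linearI simp: inner_add_left inner_add_right algebra_simps)
  moreover have "e U V = e V U" for U V by (simp add: e_def inner_commute)
  moreover have "e U U > 0" if "U \<noteq> 0" for U
  proof -
    have "fst U \<noteq> 0 \<or> snd U \<noteq> 0" using that by (simp add: prod_eq_iff)
    moreover have "fst U \<noteq> 0 \<Longrightarrow> a * (fst U \<bullet> fst U) > 0" "snd U \<noteq> 0 \<Longrightarrow> \<delta> * (snd U \<bullet> snd U) > 0"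
      "a * (fst U \<bullet> fst U) \<ge> 0" "\<delta> * (snd U \<bullet> snd U) \<ge> 0"
      using assms a_pos by simp_all
    ultimately show ?thesis unfolding e_def by linarith
  qed
  moreover have "e U (M \<delta> U) \<le> 0" for U
  proof -
    have "e U (M \<delta> U) = - \<tau> * (snd U \<bullet> snd U)"
      using assms inner_G[of "fst U" "snd U"]
      by (simp add: e_def M_eq inner_add_right inner_commute algebra_simps)
    then show ?thesis using \<tau>_pos by simp
  qed
  ultimately show ?thesis unfolding dissipative_def by (intro exI[of _ e]) blast
qed

text \<open>With \<open>W = Q(M \<delta>)\<^sup>-\<^sup>1 F\<close>, the pair \<open>(W, M \<delta> W)\<close> solves a linear system whose matrix does not depend
  on \<open>\<delta>\<close> and whose right-hand side is that of the diffusion limit up to an error of order \<open>\<delta>\<close>.\<close>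

lemma resolvent_estimate:
  assumes b: "b > 0" and c: "c > 0"
  defines "S \<equiv> \<lambda>\<delta>. inv (poly_op (quad b c) (M \<delta>))"
    and "s \<equiv> inv (poly_op (quad b c) l)"
  shows "\<exists>K. \<forall>\<^sub>F \<delta> in at_right 0. \<forall>U.
    norm (S \<delta> U - E (s (P_op U))) \<le> K * \<delta> * norm U \<and>
    norm (M \<delta> (S \<delta> U) - E (l (s (P_op U)))) \<le> K * \<delta> * norm U"
proof -
  \<comment> \<open>The argument \<open>((u, q), (y, r))\<close> stands for
    \<open>(W, M \<delta> W)\<close>. The first and third rows are the first components of
    \<open>M \<delta> W = (y, r)\<close> and of \<open>Q(M \<delta>) W = U\<close>. The second and
    fourth come from the second components, multiplied by a multiple of \<delta> to remove the
    singular factor.\<close>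
  define L0 :: "('x \<times> 'q) \<times> ('x \<times> 'q) \<Rightarrow> ('x \<times> 'q) \<times> ('x \<times> 'q)" where
    "L0 w = ((fst (snd w) + \<tau> *\<^sub>R D (snd (fst w)), a *\<^sub>R G (fst (fst w)) + snd (fst w)),
      (fst (fst w) - b *\<^sub>R fst (snd w) - (c * \<tau>) *\<^sub>R D (snd (snd w)),
       a *\<^sub>R G (fst (snd w)) + snd (snd w)))" for w
  have linear_L0: "linear L0"
    unfolding L0_def by (rule linearI) (simp_all add: linear_GD_simps algebra_simps)
  have bij_l: "bij (poly_op (quad b c) l)"
    by (rule bij_poly_op_quad[OF fin_X linear_l dissipative_l b c])
  have s: "s f - b *\<^sub>R l (s f) + c *\<^sub>R l (l (s f)) = f" for f
    unfolding poly_op_quad[OF linear_l, symmetric] s_def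
    by (rule surj_f_inv_f[OF bij_is_surj[OF bij_l]])
  \<comment> \<open>On the kernel both pairs lie in the range of \<open>E\<close> and
    \<open>y = l u\<close>, so the third row reads \<open>Q(l) u = 0\<close>.\<close>
  have "w = 0" if "L0 w = 0" for w
  proof -
    obtain u q y r where w: "w = ((u, q), (y, r))" by (metis prod.collapse)
    have q: "q = - a *\<^sub>R G u" and r: "r = - a *\<^sub>R G y"
      and y: "y + \<tau> *\<^sub>R D q = 0" and u: "u - b *\<^sub>R y - (c * \<tau>) *\<^sub>R D r = 0"
      using that by (simp_all add: L0_def w zero_prod_def eq_neg_iff_add_eq_0 add.commute)
    have y': "y = l u" using y by (simp add: q l_eq linear_GD_simps)
    have "u - b *\<^sub>R l u + c *\<^sub>R l (l u) = 0"
      using u by (simp add: r y'[symmetric] l_eq[of y] linear_GD_simps ac_simps)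
    then have "poly_op (quad b c) l u = poly_op (quad b c) l 0"
      unfolding poly_op_quad[OF linear_l] by (simp add: linear_0[OF linear_l] del: scaleR_scaleR)
    then have "u = 0" using bij_is_inj[OF bij_l] by (simp only: inj_eq)
    then show "w = 0" using y' by (simp add: w q r linear_0[OF linear_l] linear_GD_simps zero_prod_def)
  qed
  then have "inj L0" using linear_injective_0[OF linear_L0] by blast
  then obtain \<kappa> where \<kappa>: "\<kappa> > 0" "\<And>w. norm w \<le> \<kappa> * norm (L0 w)"
    using fin_dim_bounded_below[OF fin_dim_prod[OF fin_XQ fin_XQ] linear_L0] by blast
  \<comment> \<open>The summands bound the two nonzero entries of the residual \<open>?N\<close>
    below.\<close>
  define \<nu> where "\<nu> = 1 / \<tau> + (1 + b) / (c * \<tau>)"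
  have \<nu>: "\<nu> > 0" unfolding \<nu>_def using b c \<tau>_pos by (simp add: add_pos_pos)
  \<comment> \<open>The factor 2 comes from absorbing half of the error into the left-hand side, and
    \<open>\<kappa> + 1\<close> from bounding \<open>norm w0 + norm U\<close>.\<close>
  define K where "K = 2 * \<kappa> * \<nu> * (\<kappa> + 1)"
  have est: "norm (S \<delta> U - E (s (P_op U))) \<le> K * \<delta> * norm U \<and>
      norm (M \<delta> (S \<delta> U) - E (l (s (P_op U)))) \<le> K * \<delta> * norm U"
    if \<delta>: "0 < \<delta>" "\<delta> < 1 / (2 * \<kappa> * \<nu>)" for \<delta> U
  proof -
    define W u0 where "W = S \<delta> U" and "u0 = s (fst U)"
    define w w0 where "w = (W, M \<delta> W)" and "w0 = (E u0, E (l u0))"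
    define y r where "y = fst (M \<delta> W)" and "r = snd (M \<delta> W)"
    have MW: "M \<delta> W = (y, r)" by (simp only: y_def r_def prod.collapse)
    have W: "W - b *\<^sub>R M \<delta> W + c *\<^sub>R M \<delta> (M \<delta> W) = U"
      unfolding poly_op_quad[OF linear_M, symmetric] W_def S_def
      by (rule surj_f_inv_f[OF bij_is_surj[OF
            bij_poly_op_quad[OF fin_XQ linear_M dissipative_M[OF \<delta>(1)] b c]]])
    have 1: "y + \<tau> *\<^sub>R D (snd W) = 0" by (simp add: y_def M_eq)
    have 2: "a *\<^sub>R G (fst W) + snd W = \<delta> *\<^sub>R (- (1 / \<tau>) *\<^sub>R r)"
      using \<delta>(1) \<tau>_pos by (simp add: r_def M_eq)
    have "c *\<^sub>R M \<delta> (y, r) = U - W + b *\<^sub>R (y, r)" using W unfolding MW by (simp add: algebra_simps)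
    then have "- (c * \<tau>) *\<^sub>R D r = fst U - fst W + b *\<^sub>R y"
      and 5: "- (c * \<tau> / \<delta>) *\<^sub>R (a *\<^sub>R G y + r) = snd U - snd W + b *\<^sub>R r"
      unfolding M_eq by (simp_all add: prod_eq_iff)
    then have 3: "fst W - b *\<^sub>R y - (c * \<tau>) *\<^sub>R D r = fst U" by (simp add: algebra_simps)
    have "a *\<^sub>R G y + r = (- (\<delta> / (c * \<tau>)) * - (c * \<tau> / \<delta>)) *\<^sub>R (a *\<^sub>R G y + r)"
      using \<delta>(1) c \<tau>_pos by simp
    also have "\<dots> = \<delta> *\<^sub>R (- (1 / (c * \<tau>)) *\<^sub>R (snd U - snd W + b *\<^sub>R r))"
      unfolding scaleR_scaleR[symmetric] 5 by simp
    finally have 4: "a *\<^sub>R G y + r = \<delta> *\<^sub>R (- (1 / (c * \<tau>)) *\<^sub>R (snd U - snd W + b *\<^sub>R r))" .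
    let ?N = "((0, - (1 / \<tau>) *\<^sub>R r), (0, - (1 / (c * \<tau>)) *\<^sub>R (snd U - snd W + b *\<^sub>R r)))
      :: ('x \<times> 'q) \<times> ('x \<times> 'q)"
    have L0w: "L0 w = ((0, 0), (fst U, 0)) + \<delta> *\<^sub>R ?N"
      unfolding L0_def w_def MW by (simp only: fst_conv snd_conv 1 2 3 4) simp
    \<comment> \<open>The limit pair solves the same system without the term in \<delta>.\<close>
    have L0w0: "L0 w0 = ((0, 0), (fst U, 0))"
      using s[of "fst U"]
      by (simp add: L0_def w0_def E_op_def l_eq linear_GD_simps ac_simps flip: u0_def)
    have "norm w0 \<le> \<kappa> * norm (fst U)"
      using \<kappa>(2)[of w0] unfolding L0w0 by (simp add: norm_Pair)
    also have "\<dots> \<le> \<kappa> * norm U" using \<kappa>(1) by (simp add: norm_fst_le[of "fst U" "snd U", simplified])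
    finally have w0: "norm w0 \<le> \<kappa> * norm U" .
    have "norm (snd W) \<le> norm w" "norm r \<le> norm w"
      unfolding w_def MW
      by (metis norm_fst_le norm_snd_le order_trans prod.collapse fst_conv snd_conv)+
    have "norm (snd U) \<le> norm U" by (metis norm_snd_le prod.collapse)
    have "norm (snd U - snd W + b *\<^sub>R r) \<le> norm (snd U) + norm (snd W) + b * norm r"
      using b norm_triangle_ineq[of "snd U - snd W" "b *\<^sub>R r"] norm_triangle_ineq4[of "snd U" "snd W"]
      by simp
    also have "\<dots> \<le> (1 + b) * (norm w + norm U)"
    proof -
      have "b * norm r \<le> b * norm w" "0 \<le> b * norm U"
        using \<open>norm r \<le> norm w\<close> b by simp_all
      then show ?thesis using \<open>norm (snd U) \<le> norm U\<close> \<open>norm (snd W) \<le> norm w\<close>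
        by (simp add: algebra_simps)
    qed
    finally have rhs2: "norm (snd U - snd W + b *\<^sub>R r) \<le> (1 + b) * (norm w + norm U)" .
    have rhs1: "norm r \<le> norm w + norm U" using \<open>norm r \<le> norm w\<close> by (simp add: add_increasing2)
    have "norm ?N \<le> norm (- (1 / \<tau>) *\<^sub>R r) + norm (- (1 / (c * \<tau>)) *\<^sub>R (snd U - snd W + b *\<^sub>R r))"
      by (rule order_trans[OF norm_Pair_le]) (simp add: norm_Pair)
    also have "\<dots> = 1 / \<tau> * norm r + 1 / (c * \<tau>) * norm (snd U - snd W + b *\<^sub>R r)"
      using c \<tau>_pos by simp
    also have "\<dots> \<le> 1 / \<tau> * (norm w + norm U) + 1 / (c * \<tau>) * ((1 + b) * (norm w + norm U))"
      using c \<tau>_pos by (intro add_mono mult_left_mono rhs1 rhs2) simp_all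
    also have "\<dots> = \<nu> * (norm w + norm U)" by (simp add: \<nu>_def distrib_right)
    finally have N: "norm ?N \<le> \<nu> * (norm w + norm U)" .
    define x where "x = norm (w - w0)"
    have "norm w \<le> x + \<kappa> * norm U"
      using norm_triangle_ineq[of "w - w0" w0] w0 by (simp add: x_def)
    then have N': "\<nu> * (norm w + norm U) \<le> \<nu> * (x + \<kappa> * norm U + norm U)"
      using \<nu> by simp
    \<comment> \<open>The residual depends on \<open>w\<close> itself, so the error \<open>x\<close>
      reappears on the right; the restriction on \<delta> makes its coefficient at most one
      half.\<close>
    have "x \<le> \<kappa> * norm (\<delta> *\<^sub>R ?N)"
      using \<kappa>(2)[of "w - w0"] by (simp only: x_def linear_diff[OF linear_L0] L0w L0w0 add_diff_cancel_left')
    also have "\<dots> = \<kappa> * (\<delta> * norm ?N)"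
      using \<delta>(1) by (simp only: norm_scaleR abs_of_pos)
    also have "\<dots> \<le> \<kappa> * (\<delta> * (\<nu> * (x + \<kappa> * norm U + norm U)))"
      using \<kappa>(1) \<delta>(1) by (intro mult_left_mono order_trans[OF N N']) simp_all
    finally have "x \<le> \<kappa> * (\<delta> * (\<nu> * (x + \<kappa> * norm U + norm U)))" .
    then have "x \<le> (\<kappa> * \<delta> * \<nu>) * x + (\<kappa> * \<delta> * \<nu>) * ((\<kappa> + 1) * norm U)" by (simp add: algebra_simps)
    moreover have "(\<kappa> * \<delta> * \<nu>) * x \<le> 1 / 2 * x"
    proof (rule mult_right_mono)
      show "\<kappa> * \<delta> * \<nu> \<le> 1 / 2" using \<delta>(2) \<kappa>(1) \<nu> by (simp add: field_simps)
    qed (simp add: x_def)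
    ultimately have x: "x \<le> K * \<delta> * norm U" by (simp add: K_def algebra_simps)
    have "norm (W - E u0) \<le> x" "norm (M \<delta> W - E (l u0)) \<le> x"
      unfolding x_def w_def w0_def diff_Pair by (rule norm_fst_le norm_snd_le)+
    with x show ?thesis unfolding W_def u0_def P_op_def by linarith
  qed
  have "\<forall>\<^sub>F \<delta> in at_right 0. 0 < \<delta> \<and> \<delta> < 1 / (2 * \<kappa> * \<nu>)"
    unfolding eventually_at_right_field using \<kappa>(1) \<nu> by (intro exI[of _ "1 / (2 * \<kappa> * \<nu>)"]) simp
  then have "\<forall>\<^sub>F \<delta> in at_right 0. \<forall>U.
      norm (S \<delta> U - E (s (P_op U))) \<le> K * \<delta> * norm U \<and>
      norm (M \<delta> (S \<delta> U) - E (l (s (P_op U)))) \<le> K * \<delta> * norm U"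
    by (rule eventually_mono) (use est in blast)
  then show ?thesis by blast
qed

text \<open>The second family is listed separately because \<open>M \<delta>\<close> contains the
  factor \<open>1 / \<delta>\<close> and is controlled here only in combination with a
  resolvent.\<close>

lemma first_order_resolvent:
  assumes "b > 0" "c > 0"
  shows "first_order P_op E (\<lambda>\<delta>. inv (poly_op (quad b c) (M \<delta>))) (inv (poly_op (quad b c) l))"
    and "first_order P_op E (\<lambda>\<delta> U. M \<delta> (inv (poly_op (quad b c) (M \<delta>)) U))
      (\<lambda>u. l (inv (poly_op (quad b c) l) u))"
  using resolvent_estimate[OF assms] unfolding first_order_def
  by (elim exE, intro exI, elim eventually_mono, blast)+

lemma bounded_linear_resolvent:
  assumes "b > 0" "c > 0"
  shows "bounded_linear (inv (poly_op (quad b c) l))"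
    and "bounded_linear (\<lambda>u. l (inv (poly_op (quad b c) l) u))"
proof -
  show *: "bounded_linear (inv (poly_op (quad b c) l))"
    by (intro fin_dim_bounded_linear linear_inv linear_poly_op bij_poly_op_quad fin_X linear_l
        dissipative_l assms)
  show "bounded_linear (\<lambda>u. l (inv (poly_op (quad b c) l) u))"
    using bounded_linear_compose[OF fin_dim_bounded_linear[OF fin_X linear_l] *] .
qed

lemma first_order_R_fun:
  assumes "C > 0"
  shows "first_order P_op E (\<lambda>\<delta>. ratfun_op (R_fun C) (M \<delta>)) (ratfun_op (R_fun C) l)"
proof -
  let ?q1 = "quad (1/4) (1/48)" and ?q2 = "quad (a2 C) (3/2 * C)"
  define S1 S2 where "S1 \<delta> = inv (poly_op ?q1 (M \<delta>))" and "S2 \<delta> = inv (poly_op ?q2 (M \<delta>))" for \<delta>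
  define s1 s2 where "s1 = inv (poly_op ?q1 l)" and "s2 = inv (poly_op ?q2 l)"
  have q1: "(1/4::real) > 0" "(1/48::real) > 0" and q2: "a2 C > 0" "3/2 * C > 0"
    using assms a2_pos by simp_all
  note fo1 = first_order_resolvent[OF q1, folded S1_def s1_def]
  note fo2 = first_order_resolvent[OF q2, folded S2_def s2_def]
  note bl1 = bounded_linear_resolvent[OF q1, folded s1_def]
  note bl2 = bounded_linear_resolvent[OF q2, folded s2_def]
  have "bounded_linear (P_op :: 'x \<times> 'q \<Rightarrow> 'x)"
    unfolding P_op_def by (rule bounded_linear_fst)
  note comp = first_order_compose[OF this fin_dim_bounded_linear[OF fin_X linear_E] _ _ P_E]
  note scale = first_order_scaleR[OF linear_E]
  have "first_order P_op E
    (\<lambda>\<delta> U. (1 + 24 * a1 C) *\<^sub>R S2 \<delta> U + (a0 C + a1 C - 24 * C) *\<^sub>R M \<delta> (S2 \<delta> U) +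
      (- 24 * a1 C) *\<^sub>R S2 \<delta> (S1 \<delta> U) + (6 * a1 C) *\<^sub>R S2 \<delta> (M \<delta> (S1 \<delta> U)) +
      (24 * C) *\<^sub>R M \<delta> (S2 \<delta> (S1 \<delta> U)) + (- 6 * C) *\<^sub>R M \<delta> (S2 \<delta> (M \<delta> (S1 \<delta> U))))
    (\<lambda>u. (1 + 24 * a1 C) *\<^sub>R s2 u + (a0 C + a1 C - 24 * C) *\<^sub>R l (s2 u) +
      (- 24 * a1 C) *\<^sub>R s2 (s1 u) + (6 * a1 C) *\<^sub>R s2 (l (s1 u)) +
      (24 * C) *\<^sub>R l (s2 (s1 u)) + (- 6 * C) *\<^sub>R l (s2 (l (s1 u))))"
    by (intro first_order_add[OF linear_E]
        scale[OF fo2(1)] scale[OF fo2(2)]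
        scale[OF comp[OF bl2(1) bl1(1) fo2(1) fo1(1)]]
        scale[OF comp[OF bl2(1) bl1(2) fo2(1) fo1(2)]]
        scale[OF comp[OF bl2(2) bl1(1) fo2(2) fo1(1)]]
        scale[OF comp[OF bl2(2) bl1(2) fo2(2) fo1(2)]])
  then obtain K where K: "\<forall>\<^sub>F \<delta> in at_right 0. \<forall>U. norm
    ((1 + 24 * a1 C) *\<^sub>R S2 \<delta> U + (a0 C + a1 C - 24 * C) *\<^sub>R M \<delta> (S2 \<delta> U) +
      (- 24 * a1 C) *\<^sub>R S2 \<delta> (S1 \<delta> U) + (6 * a1 C) *\<^sub>R S2 \<delta> (M \<delta> (S1 \<delta> U)) +
      (24 * C) *\<^sub>R M \<delta> (S2 \<delta> (S1 \<delta> U)) + (- 6 * C) *\<^sub>R M \<delta> (S2 \<delta> (M \<delta> (S1 \<delta> U))) -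
     E (ratfun_op (R_fun C) l (P_op U))) \<le> K * \<delta> * norm U"
    unfolding first_order_def s1_def s2_def
      ratfun_op_R_fun_expansion[OF fin_X linear_l dissipative_l assms, symmetric] by blast
  have "\<forall>\<^sub>F \<delta> in at_right 0. \<forall>U.
      norm (ratfun_op (R_fun C) (M \<delta>) U - E (ratfun_op (R_fun C) l (P_op U))) \<le> K * \<delta> * norm U"
    \<comment> \<open>Positivity of \<delta> gives the dissipativity of \<open>M \<delta>\<close>
      that its expansion requires.\<close>
    using K eventually_at_right_less[of 0]
  proof eventually_elim
    case (elim \<delta>)
    then show ?case
      unfolding ratfun_op_R_fun_expansion[OF fin_XQ linear_M dissipative_M[OF elim(2)] assms]
        S1_def S2_def by blast
  qed
  then show ?thesis unfolding first_order_def by blast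
qed

end

text \<open>Since \<open>ratfun_op\<close> is total, the pole conditions certify that its values are
  the intended ones, and the equation for \<open>step\<close> ties them to the two-stage
  method.\<close>

theorem theorem5:
  fixes G :: "'x::real_inner \<Rightarrow> 'q::real_inner"
    and D :: "'q \<Rightarrow> 'x"
    and a C \<Delta>t :: real
    and Gc :: "real \<Rightarrow> 'x \<times> 'q \<Rightarrow> 'x \<times> 'q"
    and Ustar step :: "real \<Rightarrow> 'x \<times> 'q \<Rightarrow> 'x \<times> 'q"
  assumes finite_dim_X: "\<exists>B::'x set. finite B \<and> span B = UNIV"
    and finite_dim_Q: "\<exists>B::'q set. finite B \<and> span B = UNIV"
    and a_pos: "a > 0"
    and G_linear: "linear G"
    and D_linear: "linear D"
    and D_eq: "D = (\<lambda>q. - adjoint G q)"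
    and C_range: "C \<in> {C_minus..C_plus}"
    and dt_pos: "\<Delta>t > 0"
    and exact_closure: "\<And>\<delta> U. \<delta> > 0 \<Longrightarrow> Gc \<delta> U = A_op a G D \<delta> (A_op a G D \<delta> U)"
    and exact_stage1: "\<And>\<delta> U. \<delta> > 0 \<Longrightarrow>
          stage1 \<Delta>t (A_op a G D \<delta>) (Gc \<delta>) U (Ustar \<delta> U)"
    and exact_stage2: "\<And>\<delta> U. \<delta> > 0 \<Longrightarrow>
          stage2 C \<Delta>t (A_op a G D \<delta>) (Gc \<delta>) U (Ustar \<delta> U) (step \<delta> U)"
  shows "no_eigenvalue_at_pole (R_fun C) (\<lambda>u. \<Delta>t *\<^sub>R L_op a G u) \<and>
    (\<forall>\<delta>>0. no_eigenvalue_at_pole (R_fun C) (\<lambda>U. \<Delta>t *\<^sub>R A_op a G D \<delta> U) \<and>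
            step \<delta> = ratfun_op (R_fun C) (\<lambda>U. \<Delta>t *\<^sub>R A_op a G D \<delta> U)) \<and>
    (\<exists>\<delta>0>0. \<exists>K>0. \<forall>\<delta>. 0 < \<delta> \<and> \<delta> \<le> \<delta>0 \<longrightarrow>
       onorm (\<lambda>U. ratfun_op (R_fun C) (\<lambda>V. \<Delta>t *\<^sub>R A_op a G D \<delta> V) U -
                  E_op a G (ratfun_op (R_fun C) (\<lambda>u. \<Delta>t *\<^sub>R L_op a G u) (P_op U)))
         \<le> K * \<delta>)"
proof -
  interpret relaxation G D a \<Delta>t
    using finite_dim_X finite_dim_Q a_pos G_linear D_linear D_eq dt_pos
    unfolding relaxation_def fin_dim_def by blast
  have C: "C > 0" by (rule C_pos[OF C_range])
  have step: "step \<delta> = ratfun_op (R_fun C) (M \<delta>)" if "\<delta> > 0" for \<delta>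
  proof
    fix U
    note M_simps = linear_M[of \<delta>] linear_0[OF linear_M[of \<delta>]] linear_add[OF linear_M[of \<delta>]]
      linear_diff[OF linear_M[of \<delta>]] linear_cmul[OF linear_M[of \<delta>]]
    \<comment> \<open>The exact closure absorbs the squared time step, so both stages become
      polynomial equations in \<open>M \<delta>\<close>.\<close>
    have Gc: "\<Delta>t\<^sup>2 *\<^sub>R Gc \<delta> V = M \<delta> (M \<delta> V)" for V
    proof -
      have "A_op a G D \<delta> (A_op a G D \<delta> V) = (1 / \<Delta>t) *\<^sub>R M \<delta> ((1 / \<Delta>t) *\<^sub>R M \<delta> V)"
        using dt_pos by simp
      also have "\<dots> = (1 / \<Delta>t\<^sup>2) *\<^sub>R M \<delta> (M \<delta> V)"
        by (simp only: linear_cmul[OF linear_M] scaleR_scaleR) (simp add: power2_eq_square)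
      finally show ?thesis using dt_pos by (simp add: exact_closure[OF that])
    qed
    have Gc': "(k * \<Delta>t\<^sup>2) *\<^sub>R Gc \<delta> V = k *\<^sub>R M \<delta> (M \<delta> V)" for k V
      by (simp only: scaleR_scaleR[symmetric] Gc)
    have A': "(k * \<Delta>t) *\<^sub>R A_op a G D \<delta> V = k *\<^sub>R M \<delta> V" for k V by simp
    have quad3: "poly_op [:x, y, z:] (M \<delta>) V = x *\<^sub>R V + y *\<^sub>R M \<delta> V + z *\<^sub>R M \<delta> (M \<delta> V)" for x y z V
      by (simp add: M_simps del: scaleR_scaleR)
    have "Ustar \<delta> U - (1/4 * \<Delta>t) *\<^sub>R A_op a G D \<delta> (Ustar \<delta> U) + (1/48 * \<Delta>t\<^sup>2) *\<^sub>R Gc \<delta> (Ustar \<delta> U) =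
      U + (1/4 * \<Delta>t) *\<^sub>R A_op a G D \<delta> U + (1/48 * \<Delta>t\<^sup>2) *\<^sub>R Gc \<delta> U"
      using exact_stage1[OF that, of U] unfolding stage1_def by simp
    then have "poly_op (quad (1/4) (1/48)) (M \<delta>) (Ustar \<delta> U) = poly_op (quad (- 1/4) (1/48)) (M \<delta>) U"
      unfolding A' Gc' quad3 by simp
    moreover have "poly_op (quad (a2 C) (3/2 * C)) (M \<delta>) (step \<delta> U) =
      poly_op [:1, a0 C, C:] (M \<delta>) U + poly_op [:0, a1 C, - C:] (M \<delta>) (Ustar \<delta> U)"
      using exact_stage2[OF that, of U] unfolding stage2_def A' Gc' quad3 by simp
    ultimately show "step \<delta> U = ratfun_op (R_fun C) (M \<delta>) U"
      by (rule two_stages_eq_ratfun_op[OF fin_XQ linear_M dissipative_M[OF that] C])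
  qed
  obtain K where "\<forall>\<^sub>F \<delta> in at_right 0. \<forall>U.
      norm (ratfun_op (R_fun C) (M \<delta>) U - E (ratfun_op (R_fun C) l (P_op U))) \<le> K * \<delta> * norm U"
    using first_order_R_fun[OF C] unfolding first_order_def by blast
  then obtain d where "d > 0" and d: "\<And>\<delta> U. 0 < \<delta> \<Longrightarrow> \<delta> < d \<Longrightarrow>
      norm (ratfun_op (R_fun C) (M \<delta>) U - E (ratfun_op (R_fun C) l (P_op U))) \<le> K * \<delta> * norm U"
    unfolding eventually_at_right_field by blast
  \<comment> \<open>Halving \<open>d\<close> turns the strict bound on \<delta> into a closed range,
    and \<open>\<bar>K\<bar> + 1\<close> is positive whatever the sign of \<open>K\<close>.\<close>
  have "onorm (\<lambda>U. ratfun_op (R_fun C) (M \<delta>) U - E (ratfun_op (R_fun C) l (P_op U)))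
      \<le> (\<bar>K\<bar> + 1) * \<delta>" if "0 < \<delta> \<and> \<delta> \<le> d / 2" for \<delta>
  proof (rule onorm_bound)
    show "0 \<le> (\<bar>K\<bar> + 1) * \<delta>" using that by simp
    show "norm (ratfun_op (R_fun C) (M \<delta>) U - E (ratfun_op (R_fun C) l (P_op U)))
        \<le> (\<bar>K\<bar> + 1) * \<delta> * norm U" for U
    proof -
      have "K * \<delta> * norm U \<le> (\<bar>K\<bar> + 1) * \<delta> * norm U" using that by (intro mult_right_mono) auto
      moreover have "\<delta> < d" using that \<open>d > 0\<close> by simp
      ultimately show ?thesis using d[of \<delta> U] that by linarith
    qed
  qed
  moreover have "d / 2 > 0" "\<bar>K\<bar> + 1 > 0" using \<open>d > 0\<close> by simp_all
  ultimately have bound: "\<exists>\<delta>0>0. \<exists>K>0. \<forall>\<delta>. 0 < \<delta> \<and> \<delta> \<le> \<delta>0 \<longrightarrow>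
      onorm (\<lambda>U. ratfun_op (R_fun C) (M \<delta>) U - E (ratfun_op (R_fun C) l (P_op U))) \<le> K * \<delta>"
    by blast
  have "no_eigenvalue_at_pole (R_fun C) l"
    by (rule no_eigenvalue_at_pole_R_fun[OF fin_X linear_l dissipative_l C])
  moreover have "no_eigenvalue_at_pole (R_fun C) (M \<delta>)" if "\<delta> > 0" for \<delta>
    by (rule no_eigenvalue_at_pole_R_fun[OF fin_XQ linear_M dissipative_M[OF that] C])
  ultimately show ?thesis using step bound by blast
qed

end
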